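(* Let $0<a_1\leq a_2\leq\cdots\leq a_n$, $0<b_1\leq b_2\leq\cdots\leq b_n$ and $\rho>0$, and define for $x>0$ $$\chi(x)=\sqrt[x]{\rho\prod_{i=1}^n\frac{\Gamma(x+a_i)}{\Gamma(x+b_i)}}.$$ (i) If $\rho\prod_{i=1}^n\frac{\Gamma(a_i)}{\Gamma(b_i)}\geq 1$ and $\sum_{i=1}^k a_i\geq\sum_{i=1}^k b_i$ for $k=1,2,\ldots,n$, then $\chi$ is logarithmically completely monotonic on $(0,\infty)$. (ii) If $\rho\prod_{i=1}^n\frac{\Gamma(a_i)}{\Gamma(b_i)}\leq 1$ and $\sum_{i=1}^k a_i\leq\sum_{i=1}^k b_i$ for $k=1,2,\ldots,n$, then the reciprocal $1/\chi$ is logarithmically completely monotonic on $(0,\infty)$.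
   Context: $\Gamma$ is the Euler Gamma function. A positive function $f$ is logarithmically completely monotonic on an interval $I$ if it is infinitely differentiable on $I$ and $(-1)^m[\log f(x)]^{(m)}\geq 0$ for all $x\in I$ and all integers $m\geq 1$. *)

theory Defs
  imports "HOL-Analysis.Analysis"
begin

text \<open>
  The \<open>m\<close>-th derivative of \<open>f\<close> on a nondegenerate interval \<open>I\<close>. Derivatives are taken within \<open>I\<close>,
  so they are one-sided at an endpoint belonging to \<open>I\<close>, and on \<open>I\<close> they depend only on the values
  of \<open>f\<close> there. As with \<^const>\<open>deriv\<close>, the value is unspecified where \<open>f\<close> is not differentiable.
\<close>
definition nth_deriv_on :: "real set \<Rightarrow> nat \<Rightarrow> (real \<Rightarrow> real) \<Rightarrow> real \<Rightarrow> real" where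
  "nth_deriv_on I m f = ((\<lambda>g x. vector_derivative g (at x within I)) ^^ m) f"

definition infinitely_differentiable_on :: "(real \<Rightarrow> real) \<Rightarrow> real set \<Rightarrow> bool" where
  "infinitely_differentiable_on f I \<longleftrightarrow> (\<forall>m. nth_deriv_on I m f differentiable_on I)"

text \<open>
  Smoothness is only required of \<open>f\<close>; as \<open>f\<close> is positive, it carries over to \<open>\<lambda>x. ln (f x)\<close>, so
  the derivatives in the last conjunct exist.
\<close>
definition log_completely_monotonic_on :: "(real \<Rightarrow> real) \<Rightarrow> real set \<Rightarrow> bool" where
  "log_completely_monotonic_on f I \<longleftrightarrow>
     (\<forall>x\<in>I. f x > 0) \<and>
     infinitely_differentiable_on f I \<and>
     (\<forall>m\<ge>1. \<forall>x\<in>I. (-1) ^ m * nth_deriv_on I m (\<lambda>x. ln (f x)) x \<ge> 0)"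

text \<open>For \<open>x > 0\<close> and a positive radicand, the \<open>x\<close>-th root is the power with exponent \<open>1 / x\<close>.\<close>
definition chi :: "nat \<Rightarrow> (nat \<Rightarrow> real) \<Rightarrow> (nat \<Rightarrow> real) \<Rightarrow> real \<Rightarrow> real \<Rightarrow> real" where
  "chi n a b \<rho> x = (\<rho> * (\<Prod>i=1..n. Gamma (x + a i) / Gamma (x + b i))) powr (1 / x)"

end

theory Submission
  imports Defs
begin

text \<open>
  Let \<open>g x = ln (\<rho> * (\<Prod>i=1..n. Gamma (x + a i) / Gamma (x + b i)))\<close>, so that
  \<open>ln (chi x) = g x / x\<close>. The functions \<open>(-1) ^ m * Polygamma m\<close> are increasing and concave, so
  weak majorization makes \<open>g'\<close> completely monotonic. By the Leibniz rule
  \<open>(-1) ^ m * x ^ (m + 1) / m!\<close> times the \<open>m\<close>-th derivative of \<open>g x / x\<close> is the Taylor sum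
  \<open>\<Sum>k\<le>m. (-x) ^ k * (g's k-th derivative) / k!\<close>; its derivative telescopes to
  \<open>(-x) ^ m / m!\<close> times the \<open>(m + 1)\<close>-st derivative of \<open>g\<close>, which is nonnegative, and at \<open>x = 0\<close>
  the sum is \<open>g 0 \<ge> 0\<close>. Part (ii) is part (i) with \<open>a\<close> and \<open>b\<close> swapped and \<open>1 / \<rho>\<close> for \<open>\<rho>\<close>.
\<close>

section \<open>Iterated derivatives and smoothness on open sets\<close>

lemma nth_deriv_on_Suc:
  "nth_deriv_on I (Suc m) f = (\<lambda>x. vector_derivative (nth_deriv_on I m f) (at x within I))"
  by (simp add: nth_deriv_on_def)

text \<open>On an open set the derivative within \<open>I\<close> is the ordinary one, and agreement
  on \<open>I\<close> is agreement near \<open>x\<close>.\<close>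

lemma vector_derivative_within_eq_on:
  fixes f g :: "real \<Rightarrow> real"
  assumes "open I" "x \<in> I" and "\<And>y. y \<in> I \<Longrightarrow> f y = g y" and "(g has_real_derivative d) (at x)"
  shows "vector_derivative f (at x within I) = d" and "(f has_real_derivative d) (at x)"
proof -
  show *: "(f has_real_derivative d) (at x)"
    using has_field_derivative_transform_within_open[OF assms(4,1,2)] assms(3) by simp
  then show "vector_derivative f (at x within I) = d"
    using assms(1,2)
    by (simp add: at_within_open[of x I] vector_derivative_at has_real_derivative_iff_has_vector_derivative)
qed

lemma nth_deriv_on_eq:
  assumes "open I" "\<And>x. x \<in> I \<Longrightarrow> f x = F 0 x"
    and "\<And>m x. x \<in> I \<Longrightarrow> (F m has_real_derivative F (Suc m) x) (at x)"
    and "x \<in> I"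
  shows "nth_deriv_on I m f x = F m x"
  using \<open>x \<in> I\<close>
proof (induction m arbitrary: x)
  case 0
  then show ?case using assms(2) by (simp add: nth_deriv_on_def)
next
  case (Suc m)
  then show ?case
    using vector_derivative_within_eq_on(1)[OF assms(1), of x "nth_deriv_on I m f" "F m"] assms(3)
    by (simp add: nth_deriv_on_Suc)
qed

text \<open>Since \<open>C\<close> is closed under differentiation on \<open>I\<close>, induction
  shows that every iterated derivative of \<open>f\<close> agrees on \<open>I\<close> with a member
  of \<open>C\<close>, without any formula for it.\<close>

lemma infinitely_differentiable_onI:
  assumes "open I" "g \<in> C" "\<And>x. x \<in> I \<Longrightarrow> f x = g x"
    and closed: "\<And>h. h \<in> C \<Longrightarrow> \<exists>h'\<in>C. \<forall>x\<in>I. (h has_real_derivative h' x) (at x)"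
  shows "infinitely_differentiable_on f I"
proof -
  have *: "\<exists>h\<in>C. \<forall>x\<in>I. nth_deriv_on I m f x = h x" for m
  proof (induction m)
    case 0
    then show ?case using assms(2,3) by (auto simp: nth_deriv_on_def)
  next
    case (Suc m)
    then obtain h where "h \<in> C" and h: "\<forall>x\<in>I. nth_deriv_on I m f x = h x"
      by blast
    obtain h' where "h' \<in> C" "\<forall>x\<in>I. (h has_real_derivative h' x) (at x)"
      using closed[OF \<open>h \<in> C\<close>] by blast
    with h show ?case
      using vector_derivative_within_eq_on(1)[OF assms(1), of _ "nth_deriv_on I m f" h]
      by (intro bexI[of _ h']) (auto simp: nth_deriv_on_Suc)
  qed
  show ?thesis
    unfolding infinitely_differentiable_on_def
  proof
    fix m
    obtain h where "h \<in> C" and h: "\<forall>x\<in>I. nth_deriv_on I m f x = h x"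
      using * by blast
    obtain h' where h': "\<forall>x\<in>I. (h has_real_derivative h' x) (at x)"
      using closed[OF \<open>h \<in> C\<close>] by blast
    show "nth_deriv_on I m f differentiable_on I"
      unfolding differentiable_on_def
    proof
      fix x assume "x \<in> I"
      then have "(nth_deriv_on I m f has_real_derivative h' x) (at x)"
        using vector_derivative_within_eq_on(2)[OF assms(1), of x _ h] h h' by simp
      then show "nth_deriv_on I m f differentiable (at x within I)"
        using differentiable_at_withinI real_differentiable_def by blast
    qed
  qed
qed

text \<open>If the \<open>U k\<close> are the successive derivatives of \<open>U 0\<close>, this
  class contains \<open>exp (U 0 x)\<close> and is closed under differentiation. It stands in for
  the Bell polynomials in the derivatives of the exponential.\<close>

inductive_set exp_algebra :: "(nat \<Rightarrow> real \<Rightarrow> real) \<Rightarrow> (real \<Rightarrow> real) set"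
  for U :: "nat \<Rightarrow> real \<Rightarrow> real" where
  base: "U k \<in> exp_algebra U"
| exp: "(\<lambda>x. exp (U 0 x)) \<in> exp_algebra U"
| add: "f \<in> exp_algebra U \<Longrightarrow> g \<in> exp_algebra U \<Longrightarrow> (\<lambda>x. f x + g x) \<in> exp_algebra U"
| mult: "f \<in> exp_algebra U \<Longrightarrow> g \<in> exp_algebra U \<Longrightarrow> (\<lambda>x. f x * g x) \<in> exp_algebra U"

lemma exp_algebra_deriv:
  assumes "\<And>m x. x \<in> I \<Longrightarrow> (U m has_real_derivative U (Suc m) x) (at x)"
    and "f \<in> exp_algebra U"
  shows "\<exists>f'\<in>exp_algebra U. \<forall>x\<in>I. (f has_real_derivative f' x) (at x)"
  using assms(2)
proof induction
  case (base k)
  then show ?case using assms(1) exp_algebra.base by blast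
next
  case exp
  have "((\<lambda>x. exp (U 0 x)) has_real_derivative exp (U 0 x) * U 1 x) (at x)" if "x \<in> I" for x
    using assms(1)[OF that, of 0] by (auto intro!: derivative_eq_intros)
  then show ?case
    by (intro bexI[OF _ exp_algebra.mult[OF exp_algebra.exp exp_algebra.base[of U 1]]]) simp
next
  case (add f g)
  then obtain f' g' where *: "f' \<in> exp_algebra U" "g' \<in> exp_algebra U"
    "\<forall>x\<in>I. (f has_real_derivative f' x) (at x)" "\<forall>x\<in>I. (g has_real_derivative g' x) (at x)"
    by blast
  then show ?case
    by (intro bexI[OF _ exp_algebra.add[OF *(1,2)]]) (simp add: DERIV_add)
next
  case (mult f g)
  then obtain f' g' where *: "f' \<in> exp_algebra U" "g' \<in> exp_algebra U"
    "\<forall>x\<in>I. (f has_real_derivative f' x) (at x)" "\<forall>x\<in>I. (g has_real_derivative g' x) (at x)"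
    by blast
  have "(\<lambda>x. f' x * g x + g' x * f x) \<in> exp_algebra U"
    using * mult.hyps by (intro exp_algebra.intros)
  then show ?case
    by (rule bexI[rotated]) (use * in \<open>simp add: DERIV_mult\<close>)
qed

lemma infinitely_differentiable_on_exp:
  assumes "open I" "\<And>m x. x \<in> I \<Longrightarrow> (U m has_real_derivative U (Suc m) x) (at x)"
    and "\<And>x. x \<in> I \<Longrightarrow> f x = exp (U 0 x)"
  shows "infinitely_differentiable_on f I"
  by (rule infinitely_differentiable_onI[OF assms(1) exp_algebra.exp[of U] assms(3)])
    (auto intro: exp_algebra_deriv[of I U, OF assms(2)])

section \<open>Logarithmic complete monotonicity of \<open>exp (G 0 x / x)\<close>\<close>

text \<open>When \<open>G k\<close> is the k-th derivative of \<open>G 0\<close>, the sum is the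
  Taylor polynomial of \<open>G 0\<close> centred at \<open>x\<close> and evaluated at 0.
  Differentiating a new term cancels what the earlier terms left over and leaves a new top
  term.\<close>

lemma taylor_sum_has_real_derivative:
  fixes G :: "nat \<Rightarrow> real \<Rightarrow> real"
  assumes "\<And>m. (G m has_real_derivative G (Suc m) x) (at x)"
  shows "((\<lambda>x. \<Sum>k\<le>m. (- x) ^ k * G k x / fact k) has_real_derivative
          (- x) ^ m * G (Suc m) x / fact m) (at x)"
proof (induction m)
  case 0
  then show ?case using assms[of 0] by simp
next
  case (Suc m)
  have "((\<lambda>x. (- x) ^ Suc m) has_real_derivative - (real (Suc m) * (- x) ^ m)) (at x)"
    using DERIV_power_Suc[OF DERIV_minus[OF DERIV_ident], of m] by simp
  from DERIV_cdivide[OF DERIV_mult[OF this assms[of "Suc m"]], of "fact (Suc m)"]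
  have "((\<lambda>x. (- x) ^ Suc m * G (Suc m) x / fact (Suc m)) has_real_derivative
      - ((- x) ^ m * G (Suc m) x / fact m) + (- x) ^ Suc m * G (Suc (Suc m)) x / fact (Suc m)) (at x)"
  proof (rule DERIV_cong)
    have "(- (M * q) * g + g' * r) / (M * F) = - (q * g / F) + r * g' / (M * F)"
      if "M \<noteq> 0" "F \<noteq> 0" for M F q r g g' :: real
      using that by (simp add: field_simps)
    from this[of "real (Suc m)" "fact m" "(- x) ^ m" "G (Suc m) x" "G (Suc (Suc m)) x" "(- x) ^ Suc m"]
    show "(- (real (Suc m) * (- x) ^ m) * G (Suc m) x + G (Suc (Suc m)) x * (- x) ^ Suc m) / fact (Suc m)
        = - ((- x) ^ m * G (Suc m) x / fact m) + (- x) ^ Suc m * G (Suc (Suc m)) x / fact (Suc m)"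
      unfolding fact_Suc by simp
  qed
  from DERIV_add[OF Suc this] show ?case
    by (simp del: fact_Suc power_Suc)
qed

text \<open>The hypotheses on \<open>G\<close> include the endpoint 0, because the Taylor sums are
  bounded below by their value there.\<close>

lemma log_completely_monotonic_on_exp_div:
  fixes G :: "nat \<Rightarrow> real \<Rightarrow> real"
  assumes G: "\<And>m x. x \<ge> 0 \<Longrightarrow> (G m has_real_derivative G (Suc m) x) (at x)"
    and "G 0 0 \<ge> 0"
    and nonneg: "\<And>m x. x \<ge> 0 \<Longrightarrow> (-1) ^ m * G (Suc m) x \<ge> 0"
    and f: "\<And>x. x > 0 \<Longrightarrow> f x = exp (G 0 x / x)"
  shows "log_completely_monotonic_on f {0<..}"
proof -
  define T where "T m x = (\<Sum>k\<le>m. (- x) ^ k * G k x / fact k)" for m x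
  \<comment> \<open>Leibniz formula for the m-th derivative of \<open>G 0 x / x\<close>, using that
    the j-th derivative of 1 / x is (-1)^j j! / x^(j+1).\<close>
  define U where "U m x = (-1) ^ m * fact m * T m x / x ^ Suc m" for m x
  have T': "(T m has_real_derivative (- x) ^ m * G (Suc m) x / fact m) (at x)" if "x \<ge> 0" for m x
    using taylor_sum_has_real_derivative[of G, OF G[OF that]] unfolding T_def .
  have U': "(U m has_real_derivative U (Suc m) x) (at x)" if "x \<in> {0<..}" for m x
  proof -
    from that have x: "x > 0" by simp
    have TS: "T (Suc m) x = T m x + (- x) ^ Suc m * G (Suc m) x / fact (Suc m)"
      by (simp add: T_def)
    have sq: "(-1) ^ m * (- x) ^ m = x ^ m"
      by (simp flip: power_mult_distrib)
    have "(U m has_real_derivative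
        ((-1) ^ m * fact m * ((- x) ^ m * G (Suc m) x / fact m) * x ^ Suc m
          - (-1) ^ m * fact m * T m x * (real (Suc m) * x ^ m)) / (x ^ Suc m * x ^ Suc m)) (at x)"
      unfolding U_def using x T'[of x m]
      by (auto intro!: derivative_eq_intros simp del: power_Suc)
    also have "((-1) ^ m * fact m * ((- x) ^ m * G (Suc m) x / fact m) * x ^ Suc m
          - (-1) ^ m * fact m * T m x * (real (Suc m) * x ^ m)) / (x ^ Suc m * x ^ Suc m)
        = U (Suc m) x"
    proof -
      \<comment> \<open>Here \<open>e\<close>, \<open>q\<close>, \<open>F\<close>, \<open>M\<close>
        stand for (-1)^m, (-x)^m, m! and m + 1. The power x^m is entered as \<open>e * q\<close>,
        and \<open>sq\<close> turns it back.\<close>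
      have "(e * F * (q * g / F) * (x * (e * q)) - e * F * t * (M * (e * q))) / (x * (e * q) * (x * (e * q)))
          = - e * (M * F) * (t + - x * q * g / (M * F)) / (x * (x * (e * q)))"
        if "e \<noteq> 0" "q \<noteq> 0" "F \<noteq> 0" "M \<noteq> 0" for e q g F t M :: real
        using that x by (simp add: divide_simps) (simp add: algebra_simps)
      from this[of "(-1) ^ m" "(- x) ^ m" "fact m" "real (Suc m)" "G (Suc m) x" "T m x"]
      show ?thesis
        unfolding U_def TS fact_Suc sq using x by simp
    qed
    finally show ?thesis .
  qed
  have T_nonneg: "T m x \<ge> 0" if "x > 0" for m x
  proof -
    \<comment> \<open>Only k = 0 survives at 0, and 0^0 = 1 makes that term
      \<open>G 0 0\<close>.\<close>
    have "T m 0 = (\<Sum>k\<in>{0}. (- 0) ^ k * G k 0 / fact k)"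
      unfolding T_def by (rule sum.mono_neutral_right) auto
    then have "0 \<le> T m 0" using assms(2) by simp
    also have "T m 0 \<le> T m x"
    proof (rule DERIV_nonneg_imp_nondecreasing[of 0 x "T m"])
      fix y :: real assume y: "0 \<le> y"
      \<comment> \<open>The sign of \<open>(- y) ^ m\<close> is the one in \<open>nonneg\<close>, so
        \<open>T m\<close> has a nonnegative derivative.\<close>
      have "(- y) ^ m * G (Suc m) y / fact m = y ^ m * ((-1) ^ m * G (Suc m) y) / fact m"
        by (simp add: power_minus[of y])
      also have "\<dots> \<ge> 0" using nonneg[OF y] y by simp
      finally show "\<exists>d. (T m has_real_derivative d) (at y) \<and> d \<ge> 0" using T'[OF y] by blast
    qed (use that in simp)
    finally show ?thesis .
  qed
  have f_U: "f x = exp (U 0 x)" if "x \<in> {0<..}" for x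
    using f[of x] that by (simp add: U_def T_def)
  have "(-1) ^ m * nth_deriv_on {0<..} m (\<lambda>x. ln (f x)) x \<ge> 0" if "x \<in> {0<..}" for m x
  proof -
    have "(-1) ^ m * nth_deriv_on {0<..} m (\<lambda>x. ln (f x)) x = (-1) ^ m * U m x"
      by (subst nth_deriv_on_eq[of "{0<..}" _ U]) (use U' f_U that in auto)
    also have "\<dots> = fact m * T m x / x ^ Suc m"
      by (simp add: U_def mult.assoc[symmetric] flip: power_mult_distrib)
    also have "\<dots> \<ge> 0" using T_nonneg[of x m] that by simp
    finally show ?thesis .
  qed
  moreover have "infinitely_differentiable_on f {0<..}"
    by (rule infinitely_differentiable_on_exp[of _ U]) (use U' f_U in auto)
  ultimately show ?thesis
    using f_U by (simp add: log_completely_monotonic_on_def)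
qed

section \<open>Abel summation and weak majorization\<close>

text \<open>Abel summation as an induction: lowering \<open>c k\<close> to \<open>c (Suc k)\<close>
  can only decrease its product with the k-th partial sum of \<open>d\<close>, as that sum is
  nonnegative.\<close>

lemma sum_mult_antimono_nonneg:
  fixes c d :: "nat \<Rightarrow> real"
  assumes "antimono_on {1..n} c" "\<And>i. i \<in> {1..n} \<Longrightarrow> c i \<ge> 0"
    and "\<And>k. k \<in> {1..n} \<Longrightarrow> (\<Sum>i=1..k. d i) \<ge> 0"
  shows "(\<Sum>i=1..n. c i * d i) \<ge> 0"
proof -
  have partial: "c k * (\<Sum>i=1..k. d i) \<le> (\<Sum>i=1..k. c i * d i)" if "k \<in> {1..n}" for k
    using that
  proof (induction k)
    case (Suc k)
    show ?case
    \<comment> \<open>The index 0 is outside the range of the induction hypothesis; for k = 0 both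
      sides equal \<open>c 1 * d 1\<close>.\<close>
    proof (cases "k = 0")
      case False
      then have k: "k \<in> {1..n}" "Suc k \<in> {1..n}" using Suc.prems by auto
      have "c (Suc k) \<le> c k" using assms(1) k by (auto simp: monotone_on_def)
      then have "c (Suc k) * (\<Sum>i=1..k. d i) \<le> c k * (\<Sum>i=1..k. d i)"
        using assms(3)[OF k(1)] by (rule mult_right_mono)
      with Suc.IH[OF k(1)] show ?thesis by (simp add: algebra_simps)
    qed simp
  qed simp
  show ?thesis
  proof (cases "n = 0")
    case False
    then have "0 \<le> c n * (\<Sum>i=1..n. d i)" using assms(2,3) by simp
    also have "\<dots> \<le> (\<Sum>i=1..n. c i * d i)" using partial False by simp
    finally show ?thesis .
  qed simp
qed

text \<open>The Tomic-Weyl inequality for an increasing concave function.\<close>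

lemma weak_majorization_concave:
  fixes \<phi> \<phi>' \<phi>'' :: "real \<Rightarrow> real" and a b :: "nat \<Rightarrow> real"
  assumes "convex C" and "mono_on {1..n} a"
    and C: "\<And>i. i \<in> {1..n} \<Longrightarrow> a i \<in> C" "\<And>i. i \<in> {1..n} \<Longrightarrow> b i \<in> C"
    and maj: "\<And>k. k \<in> {1..n} \<Longrightarrow> (\<Sum>i=1..k. b i) \<le> (\<Sum>i=1..k. a i)"
    and \<phi>: "\<And>x. x \<in> C \<Longrightarrow> (\<phi> has_real_derivative \<phi>' x) (at x)"
    and \<phi>': "\<And>x. x \<in> C \<Longrightarrow> (\<phi>' has_real_derivative \<phi>'' x) (at x)"
    and "\<And>x. x \<in> C \<Longrightarrow> \<phi>' x \<ge> 0" and \<phi>''_nonpos: "\<And>x. x \<in> C \<Longrightarrow> \<phi>'' x \<le> 0"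
  shows "(\<Sum>i=1..n. \<phi> (b i)) \<le> (\<Sum>i=1..n. \<phi> (a i))"
proof -
  \<comment> \<open>By concavity \<open>\<phi>'\<close> decreases on \<open>C\<close>, hence along
    the increasing sequence \<open>a\<close>; these slopes are the weights in the Abel
    summation.\<close>
  have "antimono_on {1..n} (\<lambda>i. \<phi>' (a i))"
  proof (rule monotone_onI)
    fix i j assume ij: "i \<in> {1..n}" "j \<in> {1..n}" "i \<le> j"
    then have "a i \<le> a j" using assms(2) by (auto simp: monotone_on_def)
    moreover have "y \<in> C" if "a i \<le> y" "y \<le> a j" for y
      using that assms(1) C(1) ij mem_is_interval_1_I is_interval_convex_1 by metis
    ultimately show "\<phi>' (a j) \<le> \<phi>' (a i)"
      using DERIV_nonpos_imp_nonincreasing[of "a i" "a j" \<phi>'] \<phi>' \<phi>''_nonpos by metis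
  qed
  then have "0 \<le> (\<Sum>i=1..n. \<phi>' (a i) * (a i - b i))"
    using sum_mult_antimono_nonneg[of n "\<lambda>i. \<phi>' (a i)" "\<lambda>i. a i - b i"] C assms(8) maj
    by (simp add: sum_subtractf)
  also have "\<dots> \<le> (\<Sum>i=1..n. \<phi> (a i) - \<phi> (b i))"
  proof (rule sum_mono)
    fix i assume i: "i \<in> {1..n}"
    \<comment> \<open>Tangent line inequality at \<open>a i\<close>, stated for the convex function
      \<open>- \<phi>\<close>.\<close>
    have "- \<phi>' (a i) * (b i - a i) \<le> - \<phi> (b i) - - \<phi> (a i)"
      by (rule f''_imp_f'[of C "\<lambda>x. - \<phi> x" "\<lambda>x. - \<phi>' x" "\<lambda>x. - \<phi>'' x"])
        (use C i \<phi> \<phi>' \<phi>''_nonpos assms(1) in \<open>auto intro: DERIV_minus\<close>)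
    then show "\<phi>' (a i) * (a i - b i) \<le> \<phi> (a i) - \<phi> (b i)"
      by (simp add: algebra_simps)
  qed
  finally show ?thesis by (simp add: sum_subtractf)
qed

section \<open>Signs and majorization for polygamma functions\<close>

lemma Polygamma_sign:
  assumes "(x::real) > 0"
  shows "(-1) ^ m * Polygamma (Suc m) x \<ge> 0"
proof -
  have "x \<notin> \<int>\<^sub>\<le>\<^sub>0" using assms by (auto elim!: nonpos_Ints_cases)
  then show ?thesis
    using Polygamma_real_odd_pos[of x "Suc m"] Polygamma_real_even_neg[of x "Suc m"] assms
    by (cases "even m") (auto intro: less_imp_le)
qed

text \<open>Two consecutive sign patterns of \<open>Polygamma_sign\<close>, for \<open>m\<close> and
  \<open>Suc m\<close>, make \<open>(-1) ^ m * Polygamma m\<close> increasing and concave on the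
  positive reals, as the concave majorization inequality requires.\<close>

lemma weak_majorization_Polygamma:
  fixes a b :: "nat \<Rightarrow> real"
  assumes "mono_on {1..n} a" "\<And>i. i \<in> {1..n} \<Longrightarrow> a i > 0" "\<And>i. i \<in> {1..n} \<Longrightarrow> b i > 0"
    and "\<And>k. k \<in> {1..n} \<Longrightarrow> (\<Sum>i=1..k. b i) \<le> (\<Sum>i=1..k. a i)"
  shows "(-1) ^ m * (\<Sum>i=1..n. Polygamma m (b i)) \<le> (-1) ^ m * (\<Sum>i=1..n. Polygamma m (a i))"
proof -
  have *: "((\<lambda>x. (-1) ^ m * Polygamma k x) has_real_derivative (-1) ^ m * Polygamma (Suc k) x) (at x)"
    if "x > 0" for k and x :: real
  proof -
    have "x \<notin> \<int>\<^sub>\<le>\<^sub>0" using that by (auto elim!: nonpos_Ints_cases)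
    then show ?thesis by (auto intro!: derivative_eq_intros)
  qed
  have "(\<Sum>i=1..n. (-1) ^ m * Polygamma m (b i)) \<le> (\<Sum>i=1..n. (-1) ^ m * Polygamma m (a i))"
    by (rule weak_majorization_concave[of "{0<..}" n a b _ "\<lambda>x. (-1) ^ m * Polygamma (Suc m) x"
          "\<lambda>x. (-1) ^ m * Polygamma (Suc (Suc m)) x"])
      (use assms * Polygamma_sign[of _ m] Polygamma_sign[of _ "Suc m"] in auto)
  then show ?thesis by (simp add: sum_distrib_left)
qed

section \<open>Application to the function \<open>chi\<close>\<close>

lemma chi_log_completely_monotonic_on:
  fixes a b :: "nat \<Rightarrow> real"
  assumes "mono_on {1..n} a" "\<And>i. i \<in> {1..n} \<Longrightarrow> a i > 0" "\<And>i. i \<in> {1..n} \<Longrightarrow> b i > 0"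
    and "\<rho> > 0" and at_0: "\<rho> * (\<Prod>i=1..n. Gamma (a i) / Gamma (b i)) \<ge> 1"
    and maj: "\<And>k. k \<in> {1..n} \<Longrightarrow> (\<Sum>i=1..k. b i) \<le> (\<Sum>i=1..k. a i)"
  shows "log_completely_monotonic_on (chi n a b \<rho>) {0<..}"
proof -
  define P where "P x = \<rho> * (\<Prod>i=1..n. Gamma (x + a i) / Gamma (x + b i))" for x
  \<comment> \<open>The index shifts by one because the derivative of \<open>ln_Gamma\<close> is
    \<open>Polygamma 0\<close>.\<close>
  define G where "G m x = (case m of
      0 \<Rightarrow> ln \<rho> + (\<Sum>i=1..n. ln_Gamma (x + a i) - ln_Gamma (x + b i))
    | Suc k \<Rightarrow> (\<Sum>i=1..n. Polygamma k (x + a i) - Polygamma k (x + b i)))" for m and x :: real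
  have pos: "x + a i > 0" "x + b i > 0" if "x \<ge> 0" "i \<in> {1..n}" for x i
    using that assms(2,3)[of i] by auto
  have notin: "x + a i \<notin> \<int>\<^sub>\<le>\<^sub>0" "x + b i \<notin> \<int>\<^sub>\<le>\<^sub>0" if "x \<ge> 0" "i \<in> {1..n}" for x i
    using pos[OF that] by (auto elim!: nonpos_Ints_cases)
  have P_pos: "P x > 0" and ln_P: "ln (P x) = G 0 x" if "x \<ge> 0" for x
  proof -
    have "Gamma (x + a i) / Gamma (x + b i) > 0" if "i \<in> {1..n}" for i
      using pos[OF \<open>x \<ge> 0\<close> that] by simp
    moreover have "ln (Gamma (x + a i) / Gamma (x + b i)) = ln_Gamma (x + a i) - ln_Gamma (x + b i)"
      if "i \<in> {1..n}" for i
      using pos[OF \<open>x \<ge> 0\<close> that] by (simp add: ln_div ln_Gamma_real_pos less_imp_neq[symmetric])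
    moreover from calculation
    have "ln (\<Prod>i=1..n. Gamma (x + a i) / Gamma (x + b i))
        = (\<Sum>i=1..n. ln_Gamma (x + a i) - ln_Gamma (x + b i))"
      by (subst ln_prod) (fastforce intro!: sum.cong)+
    ultimately show "P x > 0" "ln (P x) = G 0 x"
      using assms(4) prod_pos[of "{1..n}" "\<lambda>i. Gamma (x + a i) / Gamma (x + b i)"]
      by (simp_all add: P_def G_def ln_mult_pos)
  qed
  show ?thesis
  proof (rule log_completely_monotonic_on_exp_div)
    show "(G m has_real_derivative G (Suc m) x) (at x)" if "x \<ge> 0" for m x
      using pos[OF that] notin[OF that] unfolding G_def
      by (cases m) (auto intro!: derivative_eq_intros sum.cong)
    show "G 0 0 \<ge> 0"
      using at_0 ln_P[of 0] by (simp add: P_def flip: ln_P)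
    \<comment> \<open>Shifting by \<open>x\<close> preserves majorization: both k-th partial sums
      grow by k x.\<close>
    show "(-1) ^ m * G (Suc m) x \<ge> 0" if "x \<ge> 0" for m x
      using weak_majorization_Polygamma[of n "\<lambda>i. x + a i" "\<lambda>i. x + b i" m]
        assms(1) pos[OF that] maj
      by (simp add: G_def sum_subtractf sum.distrib monotone_on_def right_diff_distrib)
    show "chi n a b \<rho> x = exp (G 0 x / x)" if "x > 0" for x
      using that P_pos[of x] ln_P[of x] unfolding chi_def P_def[symmetric] by (simp add: powr_def)
  qed
qed

lemma inverse_chi:
  "1 / chi n a b \<rho> x = chi n b a (1 / \<rho>) x"
  by (simp add: chi_def prod_dividef powr_divide powr_mult)

theorem theorem4p8:
  fixes n :: nat and a b :: "nat \<Rightarrow> real" and \<rho> :: real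
  assumes "n \<ge> 1"
    and "0 < a 1" and "mono_on {1..n} a"
    and "0 < b 1" and "mono_on {1..n} b"
    and "\<rho> > 0"
  shows "(\<rho> * (\<Prod>i=1..n. Gamma (a i) / Gamma (b i)) \<ge> 1 \<and>
          (\<forall>k\<in>{1..n}. (\<Sum>i=1..k. a i) \<ge> (\<Sum>i=1..k. b i)) \<longrightarrow>
            log_completely_monotonic_on (chi n a b \<rho>) {0<..}) \<and>
         (\<rho> * (\<Prod>i=1..n. Gamma (a i) / Gamma (b i)) \<le> 1 \<and>
          (\<forall>k\<in>{1..n}. (\<Sum>i=1..k. a i) \<le> (\<Sum>i=1..k. b i)) \<longrightarrow>
            log_completely_monotonic_on (\<lambda>x. 1 / chi n a b \<rho> x) {0<..})"
proof -
  \<comment> \<open>Monotonicity carries positivity from the first entries to all others.\<close>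
  have pos: "a i > 0" "b i > 0" if "i \<in> {1..n}" for i
    using assms(1,2,4) monotone_onD[OF assms(3), of 1 i] monotone_onD[OF assms(5), of 1 i] that
    by auto
  define Q where "Q = (\<Prod>i=1..n. Gamma (a i) / Gamma (b i))"
  have "Q > 0" unfolding Q_def using pos by (intro prod_pos) auto
  \<comment> \<open>Swapping \<open>a\<close> and \<open>b\<close> inverts \<open>Q\<close>, so the
    condition \<open>\<rho> * Q \<le> 1\<close> becomes (1 / \<rho>) (1 / Q) >= 1, the form required
    in part (i).\<close>
  have Q_swap: "(\<Prod>i=Suc 0..n. Gamma (b i) / Gamma (a i)) = 1 / Q"
    by (simp add: Q_def prod_dividef)
  have "log_completely_monotonic_on (chi n a b \<rho>) {0<..}"
    if "\<rho> * Q \<ge> 1" "\<forall>k\<in>{1..n}. (\<Sum>i=1..k. a i) \<ge> (\<Sum>i=1..k. b i)"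
    by (rule chi_log_completely_monotonic_on) (use assms(3,6) pos that in \<open>auto simp: Q_def\<close>)
  moreover have "log_completely_monotonic_on (\<lambda>x. 1 / chi n a b \<rho> x) {0<..}"
    if "\<rho> * Q \<le> 1" "\<forall>k\<in>{1..n}. (\<Sum>i=1..k. a i) \<le> (\<Sum>i=1..k. b i)"
    unfolding inverse_chi
    by (rule chi_log_completely_monotonic_on[of n b a "1 / \<rho>"])
      (use assms(5,6) pos that \<open>Q > 0\<close> in \<open>auto simp: Q_swap field_simps\<close>)
  ultimately show ?thesis unfolding Q_def by blast
qed

end
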